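(* The function $w$ has the following properties: (1) $w$ is multiplicative: $w(ab)=w(a)w(b)$ for any coprime $a,b\in\mathbb{N}$. (2) $w:\mathbb{N}\to C$ is injective, where $C=\{z\in\mathbb{C} : |z|=1\}$ is the unit circle in $\mathbb{C}$. (3) $\arg(w(n))\in[0,\pi)$ if $\lambda(n)=1$ and $\arg(w(n))\in(\pi,2\pi)$ if $\lambda(n)=-1$, where $\lambda$ is the Liouville function.
   Context: $\mathbb{N}=\{1,2,3,\dots\}$, $\mathbb{P}$ is the set of primes, and $G=\sum_{p\in\mathbb{P}} p^{-2}$. For $p\in\mathbb{P}$ and $k\ge 0$ put $\psi(p^k)=\frac{\pi}{p^2G}\left(1-\left(\frac{p-1}{p}\right)^k\right)$. The arithmetic function $w:\mathbb{N}\to\mathbb{C}$ is defined as the coefficients of the formal Dirichlet series $F(s)=\sum_{n=1}^\infty \frac{w(n)}{n^s} := \prod_{p\in\mathbb{P}}\left(\sum_{k=0}^\infty (-1)^k \frac{e^{i\psi(p^k)}}{p^{ks}}\right)$; explicitly, if $n=p_1^{k_1}\cdots p_J^{k_J}$ is the prime factorization of $n$ (distinct primes, $k_j\ge1$), then $w(n)=\prod_{j=1}^J (-1)^{k_j}e^{i\psi(p_j^{k_j})}$, and $w(1)=1$. Principal arguments $\arg$ are taken in $[0,2\pi)$. *)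

theory Defs
  imports "HOL-Analysis.Analysis" "HOL-Computational_Algebra.Primes"
begin

definition G :: real where
  "G = (\<Sum>\<^sub>\<infinity>p\<in>{p::nat. prime p}. 1 / real p ^ 2)"

(* psi p k is the value at the prime power p ^ k.  The two-argument form is harmless at k = 0,
   where the value is 0 for every p. *)
definition psi :: "nat \<Rightarrow> nat \<Rightarrow> real" where
  "psi p k = pi / (real p ^ 2 * G) * (1 - ((real p - 1) / real p) ^ k)"

(* The coefficient of 1 / n^s in the formal Euler product over all primes p of the series
   (SUM k. (-1)^k * exp(i * psi p k) / p^(k*s)), read off from the prime factorization of n.
   Only the values at n > 0 are meaningful. *)
definition w :: "nat \<Rightarrow> complex" where
  "w n = (\<Prod>p\<in>prime_factors n.
            (-1) ^ multiplicity p n * exp (\<i> * of_real (psi p (multiplicity p n))))"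

definition liouville :: "nat \<Rightarrow> int" where
  "liouville n = (-1) ^ size (prime_factorization n)"

end

theory Submission
  imports Defs
begin

text \<open>
  Collecting signs and exponents in the product gives \<open>w n = \<lambda>(n) e\<^sup>i\<^sup>\<theta>\<close>, where the phase
  \<open>\<theta> = phase n\<close> is the sum of \<open>\<psi>(p\<^sup>k)\<close> over the prime powers \<open>p\<^sup>k\<close> exactly dividing \<open>n\<close>.
  As \<open>\<psi>(p\<^sup>k) < \<pi> / (p\<^sup>2 G)\<close>, and the right-hand sides sum to \<open>\<pi>\<close> over all primes, the phase lies
  in \<open>[0, \<pi>)\<close>. Hence the sign \<open>\<lambda>(n)\<close> decides in which half of the circle \<open>w n\<close> lies: the argument
  is \<open>\<theta>\<close> or \<open>\<theta> + \<pi>\<close> (lemma \<open>Arg2pi_w\<close>), which gives (3).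

  It also follows that \<open>w n\<close> determines \<open>\<theta>\<close>, so (2) reduces to injectivity of the phase
  (lemma \<open>phase_inj\<close>), and this is a matter of denominators. Up to the common factor \<open>\<pi> / G\<close>, the
  contribution of \<open>p\<^sup>k\<close> is the rational \<open>(1 - ((p - 1) / p)\<^sup>k) / p\<^sup>2\<close>, whose denominator is a power
  of \<open>p\<close>. If \<open>m\<close> and \<open>n\<close> have the same phase, then for any prime \<open>q\<close> the contributions of \<open>q\<close> to the
  two phases differ by a rational whose denominator is prime to \<open>q\<close>, since the difference is
  made up by the other primes. But for distinct exponents \<open>a < b\<close> of \<open>q\<close> the denominator of this
  difference is exactly \<open>q\<^sup>b\<^sup>+\<^sup>2\<close> (lemma \<open>phase_term_diff_not_integral_at\<close>).
\<close>

section \<open>Real numbers that are integral at a prime\<close>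

text \<open>
  Rationals with denominator prime to \<open>q\<close>, as a set of reals: the localization of the integers
  at \<open>q\<close>. A multiplier \<open>d\<close> is used instead of a valuation because the phases are real numbers.
\<close>
definition integral_at :: "nat \<Rightarrow> real set" where
  "integral_at q = {x. \<exists>d::int. coprime d (int q) \<and> of_int d * x \<in> \<int>}"

lemma integral_at_0: "0 \<in> integral_at q"
  unfolding integral_at_def by (auto intro!: exI[of _ 1])

lemma integral_at_diff:
  assumes "x \<in> integral_at q" "y \<in> integral_at q"
  shows "x - y \<in> integral_at q"
proof -
  obtain d e where d: "coprime d (int q)" "of_int d * x \<in> \<int>"
    and e: "coprime e (int q)" "of_int e * y \<in> \<int>"
    using assms unfolding integral_at_def by blast
  have "of_int e * (of_int d * x) - of_int d * (of_int e * y) \<in> \<int>"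
    using Ints_diff[OF Ints_mult[OF Ints_of_int d(2)] Ints_mult[OF Ints_of_int e(2)]] .
  then have "of_int (d * e) * (x - y) \<in> \<int>"
    by (simp add: algebra_simps)
  moreover have "coprime (d * e) (int q)"
    using d(1) e(1) by simp
  ultimately show ?thesis
    unfolding integral_at_def by blast
qed

lemma integral_at_add:
  assumes "x \<in> integral_at q" "y \<in> integral_at q"
  shows "x + y \<in> integral_at q"
  using integral_at_diff[OF assms(1) integral_at_diff[OF integral_at_0 assms(2)]] by simp

lemma integral_at_sum:
  assumes "\<And>i. i \<in> A \<Longrightarrow> f i \<in> integral_at q"
  shows "sum f A \<in> integral_at q"
  using assms
  by (induction A rule: infinite_finite_induct) (auto intro: integral_at_0 integral_at_add)

section \<open>The contribution of one prime power\<close>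

text \<open>The value \<open>psi p k\<close> without the transcendental factor \<open>pi / G\<close>, which leaves a rational.\<close>
definition phase_term :: "nat \<Rightarrow> nat \<Rightarrow> real" where
  "phase_term p k = (1 - ((real p - 1) / real p) ^ k) / real p ^ 2"

lemma psi_eq_phase_term: "psi p k = pi / G * phase_term p k"
  by (simp add: psi_def phase_term_def)

lemma phase_term_0 [simp]: "phase_term p 0 = 0"
  by (simp add: phase_term_def)

lemma phase_term_less:
  assumes "prime p"
  shows "phase_term p k < 1 / real p ^ 2"
proof -
  have "real p > 1"
    using prime_gt_1_nat[OF assms] by simp
  then have "((real p - 1) / real p) ^ k > 0"
    by simp
  with \<open>real p > 1\<close> show ?thesis
    unfolding phase_term_def by (intro divide_strict_right_mono) auto
qed

lemma phase_term_pos: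
  assumes "prime p" "k > 0"
  shows "phase_term p k > 0"
proof -
  have "real p > 1"
    using prime_gt_1_nat[OF assms(1)] by simp
  then have "((real p - 1) / real p) ^ k < 1"
    using assms(2) by (simp add: power_less_one_iff)
  with \<open>real p > 1\<close> show ?thesis
    unfolding phase_term_def by simp
qed

lemma phase_term_cleared:
  assumes "p > 0"
  shows "real p ^ (k + 2) * phase_term p k = of_int (int p ^ k - (int p - 1) ^ k)"
proof -
  have "real p ^ (k + 2) * phase_term p k = real p ^ k * (1 - ((real p - 1) / real p) ^ k)"
    using assms by (simp only: power_add phase_term_def) simp
  also have "\<dots> = real p ^ k - (real p - 1) ^ k"
    using assms by (simp add: power_divide right_diff_distrib)
  finally show ?thesis
    by simp
qed

lemma phase_term_integral_at_other:
  assumes "prime p" "prime q" "p \<noteq> q"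
  shows "phase_term p k \<in> integral_at q"
proof -
  have "coprime (int p ^ (k + 2)) (int q)"
    using primes_coprime[OF assms] by (simp del: power_Suc)
  moreover have "of_int (int p ^ (k + 2)) * phase_term p k \<in> \<int>"
    using phase_term_cleared[of p k] prime_gt_0_nat[OF assms(1)]
    by (metis Ints_of_int of_int_of_nat_eq of_int_power)
  ultimately show ?thesis
    unfolding integral_at_def by blast
qed

text \<open>
  After multiplication by \<open>q\<^sup>b\<^sup>+\<^sup>2\<close> the difference is the integer
  \<open>q\<^sup>b\<^sup>-\<^sup>a (q - 1)\<^sup>a - (q - 1)\<^sup>b\<close>, which is prime to \<open>q\<close>, so no power of \<open>q\<close> cancels.
\<close>
lemma phase_term_diff_not_integral_at:
  assumes "prime q" "a < b"
  shows "phase_term q b - phase_term q a \<notin> integral_at q"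
proof
  assume "phase_term q b - phase_term q a \<in> integral_at q"
  then obtain d j where d: "coprime d (int q)"
    and j: "of_int d * (phase_term q b - phase_term q a) = of_int j"
    unfolding integral_at_def by (auto elim!: Ints_cases)
  have q: "q > 0"
    using prime_gt_0_nat[OF assms(1)] .
  have b: "b + 2 = (b - a) + (a + 2)"
    using assms(2) by simp
  have "real q ^ (b + 2) * phase_term q a
      = real q ^ (b - a) * (real q ^ (a + 2) * phase_term q a)"
    by (subst b, subst power_add) simp
  also have "\<dots> = of_int (int q ^ (b - a) * (int q ^ a - (int q - 1) ^ a))"
    by (subst phase_term_cleared[OF q]) simp
  also have "\<dots> = of_int (int q ^ b - int q ^ (b - a) * (int q - 1) ^ a)"
    using assms(2) by (simp add: right_diff_distrib flip: power_add)
  finally have "real q ^ (b + 2) * (phase_term q b - phase_term q a)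
      = of_int (int q ^ (b - a) * (int q - 1) ^ a - (int q - 1) ^ b)"
    using phase_term_cleared[OF q, of b] by (simp add: right_diff_distrib del: power_Suc)
  then have "of_int d * (real q ^ (b + 2) * (phase_term q b - phase_term q a))
      = of_int (d * (int q ^ (b - a) * (int q - 1) ^ a - (int q - 1) ^ b))"
    by (simp only: of_int_mult)
  moreover have "of_int d * (real q ^ (b + 2) * (phase_term q b - phase_term q a))
      = of_int (int q ^ (b + 2) * j)"
    by (simp only: mult.left_commute[of "of_int d"] j) simp
  ultimately have "int q ^ (b + 2) * j = d * (int q ^ (b - a) * (int q - 1) ^ a - (int q - 1) ^ b)"
    by (metis of_int_eq_iff)
  then have "d * (int q - 1) ^ b = d * int q ^ (b - a) * (int q - 1) ^ a - int q ^ (b + 2) * j"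
    by (simp add: algebra_simps)
  moreover have "int q dvd d * int q ^ (b - a) * (int q - 1) ^ a - int q ^ (b + 2) * j"
    using assms(2) by (intro dvd_diff dvd_mult dvd_mult2 dvd_power) auto
  ultimately have "int q dvd d * (int q - 1) ^ b"
    by simp
  moreover have "coprime (int q) (d * (int q - 1) ^ b)"
    using d coprime_diff_one_left[of "int q"]
    by (simp add: coprime_commute)
  ultimately have "is_unit (int q)"
    by (intro coprime_common_divisor[OF _ dvd_refl])
  then show False
    using assms(1) by (simp add: prime_nat_iff)
qed

section \<open>The phase of an integer\<close>

definition phase :: "nat \<Rightarrow> real" where
  "phase n = (\<Sum>p\<in>prime_factors n. psi p (multiplicity p n))"

text \<open>
  Sums over the primes of \<open>n\<close> may be extended by further primes, so that two phases can be compared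
  over a common index set.
\<close>
lemma phase_eq_sum_phase_term:
  assumes "finite A" "prime_factors n \<subseteq> A" "\<And>p. p \<in> A \<Longrightarrow> prime p"
  shows "phase n = pi / G * (\<Sum>p\<in>A. phase_term p (multiplicity p n))"
proof -
  have "(\<Sum>p\<in>prime_factors n. phase_term p (multiplicity p n))
      = (\<Sum>p\<in>A. phase_term p (multiplicity p n))"
  proof (rule sum.mono_neutral_left[OF assms(1,2)], intro ballI)
    fix p assume "p \<in> A - prime_factors n"
    then have "multiplicity p n = 0"
      using assms(3) by (simp add: prime_factors_multiplicity)
    then show "phase_term p (multiplicity p n) = 0"
      by simp
  qed
  then show ?thesis
    by (simp only: phase_def psi_eq_phase_term flip: sum_distrib_left)
qed

lemma summable_on_inverse_prime_squares:
  "(\<lambda>p. 1 / real p ^ 2) summable_on {p. prime p}"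
proof -
  have "summable (\<lambda>n. norm (1 / real n ^ 2))"
    using inverse_power_summable[of 2, where 'a = real] by (simp add: field_simps)
  then have "(\<lambda>n. 1 / real n ^ 2) summable_on UNIV"
    by (rule norm_summable_imp_summable_on)
  then show ?thesis
    by (rule summable_on_subset_banach) simp
qed

lemma sum_inverse_prime_squares_le_G:
  assumes "finite A" "\<And>p. p \<in> A \<Longrightarrow> prime p"
  shows "(\<Sum>p\<in>A. 1 / real p ^ 2) \<le> G"
  unfolding G_def
  by (rule finite_sum_le_infsum[OF summable_on_inverse_prime_squares assms(1)])
     (use assms(2) in auto)

lemma G_pos: "G > 0"
  using sum_inverse_prime_squares_le_G[of "{2}"] by simp

lemma phase_eq:
  "phase n = pi / G * (\<Sum>p\<in>prime_factors n. phase_term p (multiplicity p n))"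
  by (rule phase_eq_sum_phase_term) auto

lemma phase_term_prime_factor_pos:
  assumes "p \<in> prime_factors n"
  shows "phase_term p (multiplicity p n) > 0"
  using assms by (intro phase_term_pos) (auto simp: prime_factors_multiplicity)

lemma phase_nonneg: "phase n \<ge> 0"
  using G_pos phase_term_prime_factor_pos unfolding phase_eq
  by (intro mult_nonneg_nonneg sum_nonneg) (auto intro: less_imp_le)

lemma phase_pos:
  assumes "n > 1"
  shows "phase n > 0"
proof -
  have "prime_factors n \<noteq> {}"
    using assms by (simp add: prime_factorization_empty_iff)
  then have "(\<Sum>p\<in>prime_factors n. phase_term p (multiplicity p n)) > 0"
    using phase_term_prime_factor_pos by (intro sum_pos) auto
  then show ?thesis
    using G_pos unfolding phase_eq by simp
qed

lemma phase_less_pi: "phase n < pi"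
proof (cases "prime_factors n = {}")
  case True
  then show ?thesis
    by (simp add: phase_eq)
next
  case False
  have "(\<Sum>p\<in>prime_factors n. phase_term p (multiplicity p n))
      < (\<Sum>p\<in>prime_factors n. 1 / real p ^ 2)"
    using False by (intro sum_strict_mono phase_term_less) auto
  also have "\<dots> \<le> G"
    by (rule sum_inverse_prime_squares_le_G) auto
  finally show ?thesis
    using G_pos by (simp add: phase_eq field_simps)
qed

text \<open>
  Equality of the phases makes the contributions of \<open>q\<close> to the two phases differ by a combination
  of contributions of other primes, and these are integral at \<open>q\<close>.
\<close>
lemma phase_eq_imp_multiplicity_eq:
  assumes "phase m = phase n" "prime q"
  shows "multiplicity q m = multiplicity q n"
proof -
  define A where "A = insert q (prime_factors m \<union> prime_factors n)"
  define D where "D p = phase_term p (multiplicity p m) - phase_term p (multiplicity p n)" for p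
  have A: "finite A" "q \<in> A" "\<And>p. p \<in> A \<Longrightarrow> prime p"
    using assms(2) by (auto simp: A_def)
  have "phase m = pi / G * (\<Sum>p\<in>A. phase_term p (multiplicity p m))"
    "phase n = pi / G * (\<Sum>p\<in>A. phase_term p (multiplicity p n))"
    using A(1,3) by (intro phase_eq_sum_phase_term; auto simp: A_def)+
  then have "sum D A = 0"
    using assms(1) G_pos by (simp add: D_def sum_subtractf)
  then have D: "D q = 0 - sum D (A - {q})"
    using A(1,2) by (simp add: sum.remove)
  have "D p \<in> integral_at q" if "p \<in> A - {q}" for p
    unfolding D_def using that A(3) assms(2)
    by (intro integral_at_diff phase_term_integral_at_other) auto
  then have Dq: "D q \<in> integral_at q"
    unfolding D by (intro integral_at_diff integral_at_0 integral_at_sum)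
  then have "- D q \<in> integral_at q"
    using integral_at_diff[OF integral_at_0] by fastforce
  with Dq show ?thesis
    using phase_term_diff_not_integral_at[OF assms(2)]
    unfolding D_def by (metis linorder_neqE_nat minus_diff_eq)
qed

lemma phase_inj:
  assumes "m > 0" "n > 0" "phase m = phase n"
  shows "m = n"
  using assms(1,2) phase_eq_imp_multiplicity_eq[OF assms(3)] by (rule multiplicity_eq_nat)

section \<open>Sign and phase of w\<close>

lemma liouville_eq_prod: "liouville n = (\<Prod>p\<in>prime_factors n. (-1) ^ multiplicity p n)"
proof -
  have "size (prime_factorization n) = (\<Sum>p\<in>prime_factors n. multiplicity p n)"
    unfolding size_multiset_overloaded_eq
    by (intro sum.cong) (auto simp: count_prime_factorization_prime in_prime_factors_imp_prime)
  then show ?thesis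
    by (simp add: liouville_def power_sum)
qed

lemma liouville_cases: "liouville n = 1 \<or> liouville n = -1"
  unfolding liouville_def by (metis minus_one_power_iff)

lemma w_eq: "w n = of_int (liouville n) * exp (\<i> * of_real (phase n))"
  by (simp add: w_def liouville_eq_prod phase_def prod.distrib exp_sum sum_distrib_left)

lemma norm_w: "norm (w n) = 1"
  using liouville_cases[of n] by (auto simp: w_eq norm_mult)

lemma w_mult_coprime:
  assumes "a > 0" "b > 0" "coprime a b"
  shows "w (a * b) = w a * w b"
proof -
  let ?g = "\<lambda>p k. (-1) ^ k * exp (\<i> * of_real (psi p k)) :: complex"
  have nz: "a \<noteq> 0" "b \<noteq> 0"
    using assms by auto
  have other: "multiplicity p y = 0" if "p \<in> prime_factors x" "coprime x y" for p x y :: nat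
    using that by (meson coprime_common_divisor in_prime_factors_iff not_dvd_imp_multiplicity_0
        not_prime_unit)
  have disj: "prime_factors a \<inter> prime_factors b = {}"
    using other[OF _ assms(3)] by (auto simp: prime_factors_multiplicity)
  have mult: "multiplicity p (a * b) = multiplicity p a + multiplicity p b"
    if "p \<in> prime_factors a \<union> prime_factors b" for p
    using that nz by (intro prime_elem_multiplicity_mult_distrib) auto
  have "w (a * b) = (\<Prod>p\<in>prime_factors a. ?g p (multiplicity p (a * b)))
      * (\<Prod>p\<in>prime_factors b. ?g p (multiplicity p (a * b)))"
    unfolding w_def prime_factors_product[OF nz]
    using disj by (intro prod.union_disjoint) auto
  also have "(\<Prod>p\<in>prime_factors a. ?g p (multiplicity p (a * b))) = w a"
    unfolding w_def by (intro prod.cong refl) (simp add: mult other[OF _ assms(3)])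
  also have "(\<Prod>p\<in>prime_factors b. ?g p (multiplicity p (a * b))) = w b"
    unfolding w_def
    by (intro prod.cong refl)
       (simp add: mult other[OF _ coprime_commute[THEN iffD1, OF assms(3)]])
  finally show ?thesis .
qed

text \<open>A phase in \<open>[0, \<pi>)\<close> stays below \<open>2 \<pi>\<close> after the half turn that the sign may add.\<close>
lemma Arg2pi_w: "Arg2pi (w n) = (if liouville n = 1 then phase n else phase n + pi)"
proof (rule Arg2pi_unique[where r = 1])
  show "of_real 1 * exp (\<i> * of_real (if liouville n = 1 then phase n else phase n + pi)) = w n"
    using liouville_cases[of n] by (auto simp: w_eq distrib_left exp_add)
qed (use phase_nonneg[of n] phase_less_pi[of n] in auto)

lemma w_inj: "inj_on w {n. n > 0}"
proof (rule inj_onI)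
  fix m n :: nat
  assume pos: "m \<in> {n. n > 0}" "n \<in> {n. n > 0}" and "w m = w n"
  then have "(if liouville m = 1 then phase m else phase m + pi)
      = (if liouville n = 1 then phase n else phase n + pi)"
    by (metis Arg2pi_w)
  then have "phase m = phase n"
    using phase_nonneg[of m] phase_nonneg[of n] phase_less_pi[of m] phase_less_pi[of n]
    by (auto split: if_splits)
  with pos show "m = n"
    by (auto intro: phase_inj)
qed

theorem lemma1:
  shows "(\<forall>a b :: nat. a > 0 \<longrightarrow> b > 0 \<longrightarrow> coprime a b \<longrightarrow> w (a * b) = w a * w b) \<and>
         (w \<in> {n. n > 0} \<rightarrow> sphere 0 1 \<and> inj_on w {n. n > 0}) \<and>
         (\<forall>n > 0. (liouville n = 1 \<longrightarrow> Arg2pi (w n) \<in> {0..<pi}) \<and>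
                  (liouville n = -1 \<longrightarrow> Arg2pi (w n) \<in> {pi<..<2 * pi}))"
proof (intro conjI allI impI)
  fix n :: nat
  assume n: "n > 0"
  show "Arg2pi (w n) \<in> {0..<pi}" if "liouville n = 1"
    using that phase_nonneg[of n] phase_less_pi[of n] by (simp add: Arg2pi_w)
  show "Arg2pi (w n) \<in> {pi<..<2 * pi}" if "liouville n = -1"
  proof -
    \<comment> \<open>The value \<open>-1\<close> excludes \<open>n = 1\<close>, the only positive integer whose phase is \<open>0\<close>.\<close>
    have "n \<noteq> 1"
      using that by (auto simp: liouville_def)
    then show ?thesis
      using that n phase_pos[of n] phase_less_pi[of n] by (simp add: Arg2pi_w)
  qed
next
  show "w \<in> {n. n > 0} \<rightarrow> sphere 0 1"
    by (simp add: norm_w)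
qed (simp_all add: w_mult_coprime w_inj)

end
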